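(* For any natural numbers $k,s,p$, the class of $(L(s,p)+O_{0,1})$-free bipartite graphs of chordality at most $k$ is at most factorial.
   Context: Graphs are finite, simple and undirected. Every bipartite graph is given together with a bipartition of its vertex set into two independent sets (parts). A bipartite graph $G$ contains a bipartite graph $H$ as an induced subgraph if there is an induced copy of $H$ in $G$ in which the two parts of $H$ are mapped into the two different parts of $G$ (it is not specified which part of $H$ goes to which part of $G$); otherwise $G$ is $H$-free. A bipartite graph has chordality at most $k$ if it has no chordless (induced) cycle of length greater than $k$. $L(s,p)$ is the bipartite graph obtained from $K_{2,p}$ by adding $s$ pendant edges to one of the two vertices of the part of size $2$ (a vertex of degree $p$ in $K_{2,p}$); its parts have sizes $2$ and $p+s$. $L(s,p)+O_{0,1}$ is obtained from $L(s,p)$ by adding one isolated vertex to the part of size $p+s$. A hereditary class (one closed under taking induced subgraphs) is at most factorial if the number of labelled graphs in it with vertex set $\{1,\ldots,n\}$ is $2^{O(n\log n)}$. *)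

theory Defs
  imports Complex_Main "HOL-Library.Landau_Symbols"
begin

text \<open>
  A bipartite graph carries its bipartition. The two parts are ordered here, but none of the
  notions below depends on which part comes first. Edges are two-element sets of vertices.
\<close>

record 'a bigraph =
  part1 :: "'a set"
  part2 :: "'a set"
  edges :: "'a set set"

definition verts :: "'a bigraph \<Rightarrow> 'a set" where
  "verts G = part1 G \<union> part2 G"

definition bipartite_graph :: "'a bigraph \<Rightarrow> bool" where
  "bipartite_graph G \<longleftrightarrow>
     finite (verts G) \<and> part1 G \<inter> part2 G = {} \<and>
     (\<forall>e\<in>edges G. \<exists>a\<in>part1 G. \<exists>b\<in>part2 G. e = {a, b})"

definition contains_induced :: "'a bigraph \<Rightarrow> 'b bigraph \<Rightarrow> bool" where
  "contains_induced G H \<longleftrightarrow>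
     (\<exists>f. inj_on f (verts H) \<and>
          (\<forall>u\<in>verts H. \<forall>v\<in>verts H. {f u, f v} \<in> edges G \<longleftrightarrow> {u, v} \<in> edges H) \<and>
          (f ` part1 H \<subseteq> part1 G \<and> f ` part2 H \<subseteq> part2 G \<or>
           f ` part1 H \<subseteq> part2 G \<and> f ` part2 H \<subseteq> part1 G))"

definition free_of :: "'b bigraph \<Rightarrow> 'a bigraph \<Rightarrow> bool" where
  "free_of H G \<longleftrightarrow> \<not> contains_induced G H"

definition induced_cycle :: "'a bigraph \<Rightarrow> 'a list \<Rightarrow> bool" where
  "induced_cycle G c \<longleftrightarrow>
     length c \<ge> 3 \<and> distinct c \<and> set c \<subseteq> verts G \<and>
     (\<forall>i j. i < j \<and> j < length c \<longrightarrow>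
        ({c ! i, c ! j} \<in> edges G \<longleftrightarrow> j = Suc i \<or> i = 0 \<and> j = length c - 1))"

definition chordality_at_most :: "nat \<Rightarrow> 'a bigraph \<Rightarrow> bool" where
  "chordality_at_most k G \<longleftrightarrow> \<not> (\<exists>c. induced_cycle G c \<and> length c > k)"

text \<open>
  In \<open>L s p\<close> the part of size 2 is \<open>{0, 1}\<close>; the vertices \<open>2, \<dots>, p + 1\<close> form the other part
  of \<open>K\<^bsub>2,p\<^esub>\<close>, and \<open>p + 2, \<dots>, p + s + 1\<close> are the pendant vertices attached to \<open>0\<close>.
\<close>

definition L :: "nat \<Rightarrow> nat \<Rightarrow> nat bigraph" where
  "L s p =
     \<lparr> part1 = {0, 1},
       part2 = {2..<2 + p + s},
       edges = {{u, v} | u v. u \<in> {0, 1} \<and> v \<in> {2..<2 + p}} \<union>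
               {{0, v} | v. v \<in> {2 + p..<2 + p + s}} \<rparr>"

definition L_plus_O01 :: "nat \<Rightarrow> nat \<Rightarrow> nat bigraph" where
  "L_plus_O01 s p = (L s p)\<lparr> part2 := insert (2 + p + s) (part2 (L s p)) \<rparr>"

text \<open>
  Classes are represented by their members with vertices in \<open>nat\<close>. As containment is up to
  isomorphism, a hereditary class is in particular closed under isomorphism.
\<close>

definition hereditary :: "nat bigraph set \<Rightarrow> bool" where
  "hereditary X \<longleftrightarrow>
     (\<forall>G\<in>X. bipartite_graph G) \<and>
     (\<forall>G\<in>X. \<forall>H. bipartite_graph H \<and> contains_induced G H \<longrightarrow> H \<in> X)"

text \<open>
  Labelled graphs are counted together with their ordered bipartitions, which changes the
  number of graphs on \<open>n\<close> vertices by a factor of at most \<open>2 ^ n\<close>.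
\<close>

definition num_labelled :: "nat bigraph set \<Rightarrow> nat \<Rightarrow> nat" where
  "num_labelled X n = card {G \<in> X. verts G = {1..n}}"

lemma finite_labelled:
  fixes X :: "nat bigraph set"
  assumes "\<forall>G\<in>X. bipartite_graph G"
  shows "finite {G \<in> X. verts G = {1..n}}"
proof (rule finite_subset)
  let ?V = "Pow {1..n}"
  show "{G \<in> X. verts G = {1..n}} \<subseteq>
          (\<lambda>(A, B, E). \<lparr>part1 = A, part2 = B, edges = E\<rparr>) ` (?V \<times> ?V \<times> Pow ?V)"
  proof
    fix G assume G: "G \<in> {G \<in> X. verts G = {1..n}}"
    have "part1 G \<union> part2 G = {1..n}" "bipartite_graph G"
      using G assms by (auto simp: verts_def)
    then have "(part1 G, part2 G, edges G) \<in> ?V \<times> ?V \<times> Pow ?V"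
      unfolding bipartite_graph_def by fastforce
    moreover have "G = \<lparr>part1 = part1 G, part2 = part2 G, edges = edges G\<rparr>"
      by simp
    ultimately show "G \<in> (\<lambda>(A, B, E). \<lparr>part1 = A, part2 = B, edges = E\<rparr>) ` (?V \<times> ?V \<times> Pow ?V)"
      by (metis (mono_tags, lifting) case_prod_conv image_eqI)
  qed
qed auto

definition at_most_factorial :: "nat bigraph set \<Rightarrow> bool" where
  "at_most_factorial X \<longleftrightarrow>
     hereditary X \<and>
     (\<exists>f \<in> O(\<lambda>n. real n * ln (real n)). \<forall>n. real (num_labelled X n) \<le> 2 powr f n)"

end

theory Submission
  imports Defs "HOL-Probability.Product_PMF"
begin

text \<open>
  Suppose that every nonempty graph of a hereditary class has a vertex \<open>x\<close> whose neighbourhood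
  differs in at most \<open>C\<close> places from one of the following sets: the empty set, the opposite part,
  or the neighbourhood of another vertex in the part of \<open>x\<close>. Deleting such vertices one at a time
  encodes a graph on \<open>n\<close> vertices with \<open>O(log n)\<close> bits per deletion, so the class is at most
  factorial (\<open>at_most_factorialI\<close>). It remains to find \<open>C\<close>, depending on \<open>k\<close>, \<open>s\<close>, \<open>p\<close> only.

  Assume that no such vertex exists for a large \<open>C\<close>. If two vertices of a part have at least \<open>p\<close>
  common neighbours and are not close to twins, then one of them has \<open>s\<close> private neighbours, so a
  common non-neighbour would complete a copy of the forbidden graph. Hence any two vertices of a part
  have few common neighbours or together dominate the opposite part. Since all degrees and all
  co-degrees exceed \<open>C\<close>, the two kinds of pairs cannot meet in a triple, so all pairs of a part are
  of the same kind; and if all were dominating, each vertex of the opposite part would have at most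
  one non-neighbour. Thus any two vertices of a part have at most \<open>p\<close> common neighbours
  (\<open>few_common_neighbours\<close>).

  Such a graph of large minimum degree has a long induced cycle. Let \<open>A\<close> be the smaller
  part and \<open>B\<close> the larger one. For \<open>X \<subseteq> A\<close>, regard each vertex of \<open>B\<close> with exactly two neighbours
  in \<open>X\<close> as an edge on \<open>X\<close>. Any cycle of the resulting multigraph, subdivided by these vertices,
  is induced, and multiplicities are at most \<open>p\<close>; so if the induced cycles are short, then the number
  of edges is at most \<open>K \<sqdot> |X|\<close> for a constant \<open>K\<close> (\<open>dense_incidence_imp_induced_cycle\<close>). Picking
  each vertex of \<open>A\<close> with probability \<open>2^-i\<close> turns a constant proportion of the vertices of \<open>B\<close> of
  degree about \<open>2^i\<close> into edges, whence there are only \<open>O(K \<sqdot> |A| / 2^i)\<close> such vertices. Summing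
  this geometric series over all \<open>i\<close> above the minimum degree gives \<open>|B| < |A|\<close>
  (\<open>card_less_if_few_hit_twice\<close>), a contradiction.
\<close>

section \<open>Neighbourhoods and the symmetry between the parts\<close>

definition nbhd :: "'a bigraph \<Rightarrow> 'a \<Rightarrow> 'a set" where
  "nbhd G x = {y. {x, y} \<in> edges G}"

definition swap :: "'a bigraph \<Rightarrow> 'a bigraph" where
  "swap G = \<lparr>part1 = part2 G, part2 = part1 G, edges = edges G\<rparr>"

lemma swap_simps [simp]:
  "part1 (swap G) = part2 G" "part2 (swap G) = part1 G" "edges (swap G) = edges G"
  "swap (swap G) = G" "verts (swap G) = verts G" "nbhd (swap G) = nbhd G"
  by (auto simp: swap_def verts_def nbhd_def)

lemma bipartite_swap [simp]: "bipartite_graph (swap G) = bipartite_graph G"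
  unfolding bipartite_graph_def by (auto simp: insert_commute) (metis insert_commute)+

lemma contains_induced_swap [simp]: "contains_induced (swap G) H = contains_induced G H"
  unfolding contains_induced_def by auto

lemma chordality_swap [simp]: "chordality_at_most k (swap G) = chordality_at_most k G"
  unfolding chordality_at_most_def induced_cycle_def by simp

lemma nbhd_commute: "y \<in> nbhd G x \<longleftrightarrow> x \<in> nbhd G y"
  by (simp add: nbhd_def insert_commute)

lemma nbhd_part1: "bipartite_graph G \<Longrightarrow> x \<in> part1 G \<Longrightarrow> nbhd G x \<subseteq> part2 G"
  unfolding bipartite_graph_def nbhd_def by (fastforce simp: doubleton_eq_iff)

lemma nbhd_part2: "bipartite_graph G \<Longrightarrow> x \<in> part2 G \<Longrightarrow> nbhd G x \<subseteq> part1 G"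
  using nbhd_part1[of "swap G"] by simp

lemma finite_parts:
  assumes "bipartite_graph G" shows "finite (part1 G)" "finite (part2 G)"
  using assms by (auto simp: bipartite_graph_def verts_def)

lemma contains_induced_trans:
  assumes "contains_induced G H" "contains_induced H K"
  shows "contains_induced G K"
proof -
  obtain f where f: "inj_on f (verts H)"
    "\<forall>u\<in>verts H. \<forall>v\<in>verts H. {f u, f v} \<in> edges G \<longleftrightarrow> {u, v} \<in> edges H"
    "f ` part1 H \<subseteq> part1 G \<and> f ` part2 H \<subseteq> part2 G \<or> f ` part1 H \<subseteq> part2 G \<and> f ` part2 H \<subseteq> part1 G"
    using assms(1) unfolding contains_induced_def by blast
  obtain g where g: "inj_on g (verts K)"
    "\<forall>u\<in>verts K. \<forall>v\<in>verts K. {g u, g v} \<in> edges H \<longleftrightarrow> {u, v} \<in> edges K"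
    "g ` part1 K \<subseteq> part1 H \<and> g ` part2 K \<subseteq> part2 H \<or> g ` part1 K \<subseteq> part2 H \<and> g ` part2 K \<subseteq> part1 H"
    using assms(2) unfolding contains_induced_def by blast
  have gv: "g ` verts K \<subseteq> verts H" using g(3) by (auto simp: verts_def)
  have "inj_on (f \<circ> g) (verts K)"
    using f(1) g(1) gv by (meson comp_inj_on inj_on_subset)
  moreover have "\<forall>u\<in>verts K. \<forall>v\<in>verts K. {(f \<circ> g) u, (f \<circ> g) v} \<in> edges G \<longleftrightarrow> {u, v} \<in> edges K"
    using f(2) g(2) gv by (simp add: subset_iff)
  moreover have "(f \<circ> g) ` part1 K \<subseteq> part1 G \<and> (f \<circ> g) ` part2 K \<subseteq> part2 G \<or>
     (f \<circ> g) ` part1 K \<subseteq> part2 G \<and> (f \<circ> g) ` part2 K \<subseteq> part1 G"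
    using f(3) g(3) unfolding image_comp[symmetric] by (meson image_mono subset_trans)
  ultimately show ?thesis unfolding contains_induced_def by blast
qed

lemma chordality_contains_induced:
  assumes "chordality_at_most k G" "contains_induced G H"
  shows "chordality_at_most k H"
  unfolding chordality_at_most_def
proof
  obtain f where f: "inj_on f (verts H)"
    "\<forall>u\<in>verts H. \<forall>v\<in>verts H. {f u, f v} \<in> edges G \<longleftrightarrow> {u, v} \<in> edges H"
    "f ` part1 H \<subseteq> part1 G \<and> f ` part2 H \<subseteq> part2 G \<or> f ` part1 H \<subseteq> part2 G \<and> f ` part2 H \<subseteq> part1 G"
    using assms(2) unfolding contains_induced_def by blast
  have fv: "f ` verts H \<subseteq> verts G" using f(3) by (auto simp: verts_def)
  assume "\<exists>c. induced_cycle H c \<and> k < length c"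
  then obtain c where c: "induced_cycle H c" "k < length c" by blast
  have cv: "set c \<subseteq> verts H" using c(1) by (simp add: induced_cycle_def)
  have mem: "c ! i \<in> verts H" if "i < length c" for i using cv that nth_mem by blast
  have "distinct (map f c)"
    using c(1) f(1) cv by (auto simp: induced_cycle_def distinct_map intro: inj_on_subset)
  moreover have "set (map f c) \<subseteq> verts G" using cv fv by auto
  ultimately have "induced_cycle G (map f c)"
    using c(1) f(2) mem unfolding induced_cycle_def by simp
  then show False using assms(1) c(2) unfolding chordality_at_most_def by force
qed

lemma hereditary_class:
  "hereditary {G. bipartite_graph G \<and> free_of H G \<and> chordality_at_most k G}"
  unfolding hereditary_def free_of_def
  using contains_induced_trans chordality_contains_induced by blast

section \<open>Counting graphs by deleting describable vertices\<close>

definition remove_vertex :: "'a bigraph \<Rightarrow> 'a \<Rightarrow> 'a bigraph" where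
  "remove_vertex G x = \<lparr>part1 = part1 G - {x}, part2 = part2 G - {x}, edges = {e \<in> edges G. x \<notin> e}\<rparr>"

definition add_vertex :: "'a \<Rightarrow> 'a set \<Rightarrow> 'a bigraph \<Rightarrow> 'a bigraph" where
  "add_vertex x N G = \<lparr>part1 = insert x (part1 G), part2 = part2 G, edges = edges G \<union> (\<lambda>y. {x, y}) ` N\<rparr>"

text \<open>
  The sets that may approximate the neighbourhood of a vertex about to be added to \<open>part1 G\<close>.
  Their number is linear in the number of vertices, so naming one costs \<open>O(log n)\<close> bits.
\<close>

definition templates :: "'a bigraph \<Rightarrow> 'a set set" where
  "templates G = insert {} (insert (part2 G) (nbhd G ` part1 G))"

text \<open>
  The templates are those of the graph without \<open>x\<close>: a decoder that has already rebuilt this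
  graph can recover \<open>x\<close> from a template and a correction set of size at most \<open>C\<close>. Vertices of
  \<open>part2 G\<close> are treated through \<open>swap G\<close>.
\<close>

definition describable :: "nat \<Rightarrow> 'a bigraph \<Rightarrow> 'a \<Rightarrow> bool" where
  "describable C G x \<longleftrightarrow>
     x \<in> part1 G \<and> (\<exists>M\<in>templates (remove_vertex G x). card (sym_diff (nbhd G x) M) \<le> C)"

lemma add_remove_vertex:
  assumes "bipartite_graph G" "x \<in> part1 G"
  shows "add_vertex x (nbhd G x) (remove_vertex G x) = G"
proof -
  have "x \<notin> part2 G" using assms by (auto simp: bipartite_graph_def)
  moreover have "{e \<in> edges G. x \<notin> e} \<union> (\<lambda>y. {x, y}) ` nbhd G x = edges G"
  proof -
    have "e \<in> (\<lambda>y. {x, y}) ` nbhd G x" if e: "e \<in> edges G" "x \<in> e" for e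
    proof -
      obtain a b where "e = {a, b}" using assms e(1) unfolding bipartite_graph_def by metis
      then obtain y where "e = {x, y}" using e(2) by blast
      then show ?thesis using e(1) by (auto simp: nbhd_def)
    qed
    then show ?thesis by (auto simp: nbhd_def)
  qed
  ultimately show ?thesis
    using assms(2) by (simp add: add_vertex_def remove_vertex_def insert_absorb)
qed

lemma remove_vertex_swap: "remove_vertex (swap G) x = swap (remove_vertex G x)"
  by (simp add: remove_vertex_def swap_def)

lemma verts_remove_vertex: "verts (remove_vertex G x) = verts G - {x}"
  by (auto simp: verts_def remove_vertex_def)

lemma bipartite_remove_vertex:
  assumes "bipartite_graph G" shows "bipartite_graph (remove_vertex G x)"
  unfolding bipartite_graph_def
proof (intro conjI ballI)
  show "finite (verts (remove_vertex G x))" "part1 (remove_vertex G x) \<inter> part2 (remove_vertex G x) = {}"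
    using assms by (auto simp: verts_remove_vertex bipartite_graph_def) (auto simp: remove_vertex_def)
  fix e assume "e \<in> edges (remove_vertex G x)"
  then have e: "e \<in> edges G" "x \<notin> e" by (auto simp: remove_vertex_def)
  then obtain a b where "a \<in> part1 G" "b \<in> part2 G" "e = {a, b}"
    using assms unfolding bipartite_graph_def by blast
  with e(2) show "\<exists>a\<in>part1 (remove_vertex G x). \<exists>b\<in>part2 (remove_vertex G x). e = {a, b}"
    by (intro bexI[of _ a] bexI[of _ b]) (auto simp: remove_vertex_def)
qed

lemma contains_induced_remove_vertex: "contains_induced G (remove_vertex G x)"
  unfolding contains_induced_def
  by (rule exI[of _ id]) (auto simp: remove_vertex_def verts_def)

text \<open>
  A set of size at most \<open>C\<close> is listed by a word of length \<open>C\<close> over \<open>S\<close> and one padding letter.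
\<close>

lemma card_small_subsets:
  assumes "finite S"
  shows "card {D. D \<subseteq> S \<and> card D \<le> C} \<le> (card S + 1) ^ C"
proof -
  let ?T = "insert None (Some ` S)"
  let ?F = "{xs. set xs \<subseteq> ?T \<and> length xs = C}"
  have fin: "finite ?F" using assms by (intro finite_lists_length_eq) simp
  have "{D. D \<subseteq> S \<and> card D \<le> C} \<subseteq> (\<lambda>xs. {x. Some x \<in> set xs}) ` ?F"
  proof clarify
    fix D assume D: "D \<subseteq> S" "card D \<le> C"
    then obtain ys where ys: "set ys = D" "distinct ys"
      using assms finite_distinct_list finite_subset by metis
    let ?xs = "map Some ys @ replicate (C - length ys) None"
    have "length ys \<le> C" using ys D(2) distinct_card by metis
    then have "?xs \<in> ?F" using ys D by auto
    moreover have "D = {x. Some x \<in> set ?xs}" using ys by auto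
    ultimately show "D \<in> (\<lambda>xs. {x. Some x \<in> set xs}) ` ?F" by blast
  qed
  then have "card {D. D \<subseteq> S \<and> card D \<le> C} \<le> card ?F"
    using fin by (rule surj_card_le[rotated])
  also have "\<dots> = (card S + 1) ^ C"
    using assms by (simp add: card_lists_length_eq card_insert_if card_image)
  finally show ?thesis .
qed

text \<open>
  All graphs that a decoder can produce from \<open>G\<close> by adding \<open>x\<close> to the first part.
\<close>

definition extensions :: "nat \<Rightarrow> 'a \<Rightarrow> 'a bigraph \<Rightarrow> 'a bigraph set" where
  "extensions C x G =
     (\<lambda>(M, D). add_vertex x (sym_diff M D) G) ` (templates G \<times> {D. D \<subseteq> verts G \<and> card D \<le> C})"

lemma extensions_finite_card:
  assumes "bipartite_graph G"
  shows "finite (extensions C x G)" "card (extensions C x G) \<le> (card (verts G) + 2) ^ (C + 1)"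
proof -
  let ?n = "card (verts G)"
  let ?S = "{D. D \<subseteq> verts G \<and> card D \<le> C}"
  have fv: "finite (verts G)" using assms by (simp add: bipartite_graph_def)
  have ft: "finite (templates G)" using finite_parts[OF assms] by (simp add: templates_def)
  have fs: "finite ?S" using fv by simp
  show "finite (extensions C x G)" unfolding extensions_def using ft fs by blast
  have "card (templates G) \<le> card (nbhd G ` part1 G) + 2"
    unfolding templates_def by (intro order.trans[OF card_insert_le_m1]) (auto simp: card_insert_le_m1)
  also have "card (nbhd G ` part1 G) \<le> card (part1 G)"
    using finite_parts[OF assms] by (simp add: card_image_le)
  also have "card (part1 G) \<le> ?n" using fv by (intro card_mono) (auto simp: verts_def)
  finally have t: "card (templates G) \<le> ?n + 2" by simp
  have "card (extensions C x G) \<le> card (templates G \<times> ?S)"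
    unfolding extensions_def using ft fs by (intro card_image_le) blast
  also have "\<dots> = card (templates G) * card ?S" by (rule card_cartesian_product)
  also have "\<dots> \<le> (?n + 2) * (?n + 2) ^ C"
    using t card_small_subsets[OF fv, of C] by (intro mult_mono order.trans[OF card_small_subsets[OF fv]] power_mono) auto
  finally show "card (extensions C x G) \<le> (?n + 2) ^ (C + 1)" by simp
qed

lemma describable_imp_extension:
  assumes G: "bipartite_graph G" and d: "describable C G x"
  shows "G \<in> extensions C x (remove_vertex G x)"
proof -
  let ?R = "remove_vertex G x"
  obtain M where M: "x \<in> part1 G" "M \<in> templates ?R" "card (sym_diff (nbhd G x) M) \<le> C"
    using d unfolding describable_def by blast
  let ?D = "sym_diff (nbhd G x) M"
  have x2: "x \<notin> part2 G" using G M(1) by (auto simp: bipartite_graph_def)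
  have "M \<subseteq> verts ?R"
    using M(2) nbhd_part1[OF bipartite_remove_vertex[OF G, of x]] unfolding templates_def verts_def by blast
  moreover have "nbhd G x \<subseteq> verts ?R"
    using nbhd_part1[OF G M(1)] x2 unfolding verts_def remove_vertex_def by auto
  ultimately have D: "?D \<subseteq> verts ?R" by blast
  have "sym_diff M ?D = nbhd G x" by blast
  then have "G = add_vertex x (sym_diff M ?D) ?R" using add_remove_vertex[OF G M(1)] by simp
  with M(2,3) D show ?thesis unfolding extensions_def by (intro image_eqI[of _ _ "(M, ?D)"]) auto
qed

text \<open>
  A graph on \<open>S\<close> is an extension, on one of the two sides, of a graph on \<open>S - {x}\<close> for some
  \<open>x \<in> S\<close>, and a given graph has only polynomially many extensions. For the induction, \<open>S\<close> is an
  arbitrary set of labels.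
\<close>

lemma card_labelled_le:
  fixes X :: "nat bigraph set"
  assumes X: "hereditary X"
    and desc: "\<And>G. G \<in> X \<Longrightarrow> verts G \<noteq> {} \<Longrightarrow> \<exists>x. describable C G x \<or> describable C (swap G) x"
  shows "finite S \<Longrightarrow> card S = n \<Longrightarrow>
    finite {G \<in> X. verts G = S} \<and> card {G \<in> X. verts G = S} \<le> (n + 1) ^ ((C + 3) * n)"
proof (induction n arbitrary: S)
  case 0
  then have S: "S = {}" by simp
  have "{G \<in> X. verts G = S} \<subseteq> {\<lparr>part1 = {}, part2 = {}, edges = {}\<rparr>}"
  proof
    fix G assume "G \<in> {G \<in> X. verts G = S}"
    then have "bipartite_graph G" "verts G = {}" using X S by (auto simp: hereditary_def)
    then show "G \<in> {\<lparr>part1 = {}, part2 = {}, edges = {}\<rparr>}"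
      by (auto simp: bipartite_graph_def verts_def intro!: bigraph.equality)
  qed
  from card_mono[OF _ this] finite_subset[OF this] show ?case by simp
next
  case (Suc n)
  define \<G> where "\<G> S = {G \<in> X. verts G = S}" for S
  define ext where "ext x G = extensions C x G \<union> swap ` extensions C x (swap G)" for x and G :: "nat bigraph"
  have bip: "bipartite_graph G" if "G \<in> X" for G using X that by (auto simp: hereditary_def)
  have sub: "\<G> S \<subseteq> (\<Union>x\<in>S. \<Union>G'\<in>\<G> (S - {x}). ext x G')"
  proof
    fix G assume "G \<in> \<G> S"
    then have G: "G \<in> X" "verts G = S" by (auto simp: \<G>_def)
    then have "verts G \<noteq> {}" using Suc.prems by auto
    then obtain x where x: "describable C G x \<or> describable C (swap G) x" using desc G by blast
    have "x \<in> S" using x G(2) by (auto simp: describable_def verts_def)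
    moreover have "remove_vertex G x \<in> \<G> (S - {x})"
    proof -
      have "remove_vertex G x \<in> X"
        using X G(1) bipartite_remove_vertex[OF bip[OF G(1)], of x] contains_induced_remove_vertex[of G x]
        unfolding hereditary_def by blast
      then show ?thesis using G(2) by (simp add: \<G>_def verts_remove_vertex)
    qed
    moreover have "G \<in> ext x (remove_vertex G x)"
      using x
    proof
      assume "describable C G x"
      then show ?thesis using describable_imp_extension[OF bip[OF G(1)]] by (simp add: ext_def)
    next
      assume "describable C (swap G) x"
      then have "swap G \<in> extensions C x (swap (remove_vertex G x))"
        using describable_imp_extension[of "swap G"] bip[OF G(1)] by (simp add: remove_vertex_swap)
      then have "G \<in> swap ` extensions C x (swap (remove_vertex G x))"
        by (metis image_eqI swap_simps(4))
      then show ?thesis by (simp add: ext_def)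
    qed
    ultimately show "G \<in> (\<Union>x\<in>S. \<Union>G'\<in>\<G> (S - {x}). ext x G')" by blast
  qed
  have ext: "finite (ext x G)" "card (ext x G) \<le> 2 * (n + 2) ^ (C + 1)"
    if "x \<in> S" "G \<in> \<G> (S - {x})" for x G
  proof -
    have G: "bipartite_graph G" "bipartite_graph (swap G)" "card (verts G) = n"
      using that bip Suc.prems by (auto simp: \<G>_def)
    note e1 = extensions_finite_card[OF G(1), of C x]
    note e2 = extensions_finite_card[OF G(2), of C x]
    show "finite (ext x G)" unfolding ext_def using e1(1) e2(1) by simp
    have "card (ext x G) \<le> card (extensions C x G) + card (swap ` extensions C x (swap G))"
      unfolding ext_def by (rule card_Un_le)
    also have "\<dots> \<le> card (extensions C x G) + card (extensions C x (swap G))"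
      using card_image_le[OF e2(1)] by simp
    finally show "card (ext x G) \<le> 2 * (n + 2) ^ (C + 1)" using e1(2) e2(2) G(3) by simp
  qed
  have IH: "finite (\<G> (S - {x}))" "card (\<G> (S - {x})) \<le> (n + 1) ^ ((C + 3) * n)" if "x \<in> S" for x
    using Suc.IH[of "S - {x}"] Suc.prems that by (auto simp: \<G>_def)
  have fin: "finite (\<Union>x\<in>S. \<Union>G'\<in>\<G> (S - {x}). ext x G')"
    using Suc.prems(1) IH(1) ext(1) by blast
  have "card (\<G> S) \<le> card (\<Union>x\<in>S. \<Union>G'\<in>\<G> (S - {x}). ext x G')"
    using fin sub by (rule card_mono)
  also have "\<dots> \<le> (\<Sum>x\<in>S. card (\<Union>G'\<in>\<G> (S - {x}). ext x G'))"
    using Suc.prems(1) by (rule card_UN_le)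
  also have "\<dots> \<le> (\<Sum>x\<in>S. \<Sum>G'\<in>\<G> (S - {x}). card (ext x G'))"
    using IH(1) by (intro sum_mono card_UN_le)
  also have "\<dots> \<le> (\<Sum>x\<in>S. \<Sum>G'\<in>\<G> (S - {x}). 2 * (n + 2) ^ (C + 1))"
    using ext(2) by (intro sum_mono)
  also have "\<dots> \<le> (\<Sum>x\<in>S. (n + 1) ^ ((C + 3) * n) * (2 * (n + 2) ^ (C + 1)))"
    using IH(2) by (intro sum_mono) (simp only: sum_constant of_nat_id, rule mult_right_mono, auto)
  also have "\<dots> = (n + 1) ^ ((C + 3) * n) * ((2 * Suc n) * (n + 2) ^ (C + 1))"
    using Suc.prems(2) by (simp add: algebra_simps)
  also have "\<dots> \<le> (n + 2) ^ ((C + 3) * n) * ((n + 2) ^ 2 * (n + 2) ^ (C + 1))"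
    by (intro mult_mono power_mono) (auto simp: power2_eq_square)
  also have "\<dots> = (n + 2) ^ ((C + 3) * n + (2 + (C + 1)))" by (simp only: power_add)
  also have "(C + 3) * n + (2 + (C + 1)) = (C + 3) * Suc n" by simp
  finally have "card (\<G> S) \<le> (Suc n + 1) ^ ((C + 3) * Suc n)" by simp
  moreover have "finite (\<G> S)" using fin sub by (rule finite_subset[rotated])
  ultimately show ?case by (simp add: \<G>_def)
qed

lemma at_most_factorialI:
  assumes X: "hereditary X"
    and desc: "\<And>G. G \<in> X \<Longrightarrow> verts G \<noteq> {} \<Longrightarrow> \<exists>x. describable C G x \<or> describable C (swap G) x"
  shows "at_most_factorial X"
proof -
  define f where "f n = real ((C + 3) * n) * log 2 (real n + 1)" for n :: nat
  have "num_labelled X n \<le> (n + 1) ^ ((C + 3) * n)" for n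
    unfolding num_labelled_def using card_labelled_le[OF X desc, of "{1..n}" n] by simp
  then have "real (num_labelled X n) \<le> real ((n + 1) ^ ((C + 3) * n))" for n
    by (simp only: of_nat_le_iff)
  moreover have "real ((n + 1) ^ ((C + 3) * n)) = 2 powr f n" for n
  proof -
    have "2 powr f n = (2 powr log 2 (real n + 1)) powr real ((C + 3) * n)"
      by (simp only: f_def powr_powr mult.commute)
    also have "\<dots> = (real n + 1) ^ ((C + 3) * n)" by (simp add: powr_realpow del: of_nat_mult)
    finally show ?thesis by (simp add: add.commute)
  qed
  ultimately have "\<forall>n. real (num_labelled X n) \<le> 2 powr f n" by simp
  moreover have "f \<in> O(\<lambda>n. real n * ln (real n))"
  proof (rule bigoI[of _ "2 * real (C + 3) / ln 2"])
    show "\<forall>\<^sub>F n in sequentially. norm (f n) \<le> 2 * real (C + 3) / ln 2 * norm (real n * ln (real n))"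
      using eventually_ge_at_top[of 2]
    proof eventually_elim
      case (elim n)
      have "2 * real n \<le> real n * real n" using elim by (intro mult_right_mono) auto
      then have "real n + 1 \<le> real n * real n" using elim by linarith
      then have "ln (real n + 1) \<le> ln (real n * real n)" using elim by simp
      also have "\<dots> = 2 * ln (real n)" using elim by (simp add: ln_mult)
      finally have "ln (real n + 1) \<le> 2 * ln (real n)" .
      then have "real ((C + 3) * n) / ln 2 * ln (real n + 1) \<le> real ((C + 3) * n) / ln 2 * (2 * ln (real n))"
        by (intro mult_left_mono) auto
      moreover have "0 \<le> f n" by (simp add: f_def)
      moreover have "0 \<le> real n * ln (real n)" using elim by simp
      ultimately show ?case by (simp add: f_def log_def field_simps)
    qed
  qed
  ultimately show ?thesis unfolding at_most_factorial_def using X by blast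
qed

section \<open>Induced cycles from subdivided multigraphs\<close>

text \<open>
  All neighbours of the first vertex of a longest path lie on the path. The one that is farthest
  along the path closes a cycle, and it has at least \<open>m\<close> predecessors.
\<close>

lemma min_degree_imp_long_cycle:
  fixes r :: "'a \<Rightarrow> 'a \<Rightarrow> bool"
  assumes "finite X" "X \<noteq> {}" "m \<ge> 1" and irrefl: "\<And>x. \<not> r x x"
    and sym: "\<And>x y. r x y \<Longrightarrow> r y x"
    and deg: "\<And>x. x \<in> X \<Longrightarrow> m \<le> card {z \<in> X. r x z}"
  obtains xs where "distinct xs" "set xs \<subseteq> X" "length xs > m"
    "\<And>i. i < length xs \<Longrightarrow> r (xs ! i) (xs ! (Suc i mod length xs))"
proof -
  define P where "P xs \<longleftrightarrow> xs \<noteq> [] \<and> distinct xs \<and> set xs \<subseteq> X \<and> (\<forall>i. Suc i < length xs \<longrightarrow> r (xs ! i) (xs ! Suc i))" for xs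
  obtain x0 where "x0 \<in> X" using assms(2) by blast
  then have "P [x0]" by (simp add: P_def)
  moreover have "\<forall>xs. P xs \<longrightarrow> length xs \<le> card X"
    using assms(1) unfolding P_def by (metis card_mono distinct_card)
  ultimately obtain xs where xs: "P xs" and max: "\<And>ys. P ys \<Longrightarrow> length ys \<le> length xs"
    using ex_has_greatest_nat_lemma[of P "[x0]" length "card X"] ex_has_greatest_nat[of P "[x0]" length "Suc (card X)"]
    by (metis less_Suc_eq_le)
  have ne: "xs \<noteq> []" and dist: "distinct xs" and sub: "set xs \<subseteq> X"
    and adj: "\<And>i. Suc i < length xs \<Longrightarrow> r (xs ! i) (xs ! Suc i)"
    using xs by (auto simp: P_def)
  define J where "J = {i. i < length xs \<and> r (xs ! 0) (xs ! i)}"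
  have "{z \<in> X. r (xs ! 0) z} \<subseteq> (!) xs ` J"
  proof clarify
    fix z assume z: "z \<in> X" "r (xs ! 0) z"
    have "z \<in> set xs"
    proof (rule ccontr)
      assume "z \<notin> set xs"
      then have "P (z # xs)"
        using z ne dist sub adj sym by (auto simp: P_def nth_Cons split: nat.split)
      then show False using max by fastforce
    qed
    then show "z \<in> (!) xs ` J" using z by (auto simp: J_def in_set_conv_nth)
  qed
  moreover have finJ: "finite J" by (simp add: J_def)
  ultimately have "card {z \<in> X. r (xs ! 0) z} \<le> card J" by (rule surj_card_le[rotated])
  moreover have "xs ! 0 \<in> X" using ne sub by (simp add: subset_iff)
  ultimately have mJ: "m \<le> card J" using deg order.trans by blast
  then have Jne: "J \<noteq> {}" using assms(3) by auto
  define j where "j = Max J"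
  have jJ: "j \<in> J" using finJ Jne by (simp add: j_def)
  have "0 \<notin> J" using irrefl by (simp add: J_def)
  then have "J \<subseteq> {1..j}" using finJ unfolding j_def
    by (metis Max_ge atLeastAtMost_iff le_zero_eq not_less_eq_eq One_nat_def subsetI)
  then have "card J \<le> j" using card_mono[of "{1..j}" J] by simp
  then have mj: "m \<le> j" using mJ by simp
  define ys where "ys = take (Suc j) xs"
  have jl: "j < length xs" "r (xs ! 0) (xs ! j)" using jJ by (auto simp: J_def)
  have len: "length ys = Suc j" using jl by (simp add: ys_def)
  show ?thesis
  proof (rule that[of ys])
    show "distinct ys" "set ys \<subseteq> X" using dist sub by (auto simp: ys_def dest: in_set_takeD)
    show "length ys > m" using len mj by simp
    fix i assume i: "i < length ys"
    show "r (ys ! i) (ys ! (Suc i mod length ys))"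
    proof (cases "i = j")
      case True
      then show ?thesis using len sym[OF jl(2)] by (simp add: ys_def)
    next
      case False
      then show ?thesis using i len adj[of i] jl by (simp add: ys_def)
    qed
  qed
qed

text \<open>
  The list \<open>xs\<close> is a cycle of the multigraph on \<open>X\<close> whose edges are the vertices with exactly
  two neighbours in \<open>X\<close>. No subdivision vertex has a third neighbour in \<open>X\<close>, so the subdivided
  cycle is chordless even if \<open>xs\<close> has chords.
\<close>

lemma induced_cycle_subdivision:
  assumes G: "bipartite_graph G"
    and xs: "distinct xs" "set xs \<subseteq> X" "X \<subseteq> part1 G" "length xs \<ge> 3"
    and ex: "\<And>i. i < length xs \<Longrightarrow> \<exists>y\<in>part2 G. nbhd G y \<inter> X = {xs ! i, xs ! (Suc i mod length xs)}"
  shows "\<exists>c. induced_cycle G c \<and> length c = 2 * length xs"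
proof -
  define l where "l = length xs"
  have l: "3 \<le> l" using xs by (simp add: l_def)
  define nx where "nx i = (if Suc i = l then 0 else Suc i)" for i
  have nx: "nx i < l" "Suc i mod l = nx i" if "i < l" for i using that by (auto simp: nx_def)
  obtain y where y: "\<And>i. i < l \<Longrightarrow> y i \<in> part2 G"
      "\<And>i. i < l \<Longrightarrow> nbhd G (y i) \<inter> X = {xs ! i, xs ! nx i}"
    using ex nx(2) unfolding l_def[symmetric] by metis
  have inj: "xs ! i = xs ! j \<longleftrightarrow> i = j" if "i < l" "j < l" for i j
    using that xs(1) by (simp add: l_def nth_eq_iff_index_eq)
  have xX: "xs ! i \<in> X" if "i < l" for i using that xs(2) by (auto simp: l_def)
  have adj: "{y b, xs ! a} \<in> edges G \<longleftrightarrow> a = b \<or> a = nx b" if "a < l" "b < l" for a b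
  proof -
    have "{y b, xs ! a} \<in> edges G \<longleftrightarrow> xs ! a \<in> nbhd G (y b) \<inter> X"
      using xX that by (auto simp: nbhd_def)
    then show ?thesis using y(2)[OF that(2)] inj nx that by auto
  qed
  have yinj: "y a = y b \<longleftrightarrow> a = b" if "a < l" "b < l" for a b
  proof
    assume "y a = y b"
    then have "{xs ! a, xs ! nx a} = {xs ! b, xs ! nx b}" using y(2) that by metis
    then have "a = b \<or> (a = nx b \<and> nx a = b)" using inj nx that by (auto simp: doubleton_eq_iff)
    \<comment> \<open>On a cycle of length 2, the two edges would join the same two vertices.\<close>
    then show "a = b" using l that by (auto simp: nx_def split: if_splits)
  qed simp
  have x1: "xs ! a \<in> part1 G" if "a < l" for a using xX[OF that] xs(3) by blast
  have disj: "part1 G \<inter> part2 G = {}" using G by (simp add: bipartite_graph_def)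
  have no1: "{u, v} \<notin> edges G" if "u \<in> part1 G" "v \<in> part1 G" for u v
    using nbhd_part1[OF G that(1)] that disj by (auto simp: nbhd_def)
  have no2: "{u, v} \<notin> edges G" if "u \<in> part2 G" "v \<in> part2 G" for u v
    using nbhd_part2[OF G that(1)] that disj by (auto simp: nbhd_def)
  have xy: "xs ! a \<noteq> y b" if "a < l" "b < l" for a b using x1[of a] y(1)[of b] that disj by auto
  \<comment> \<open>Vertices of \<open>X\<close> are at the even positions, their subdivision vertices at the odd ones.\<close>
  define c where "c = map (\<lambda>j. if even j then xs ! (j div 2) else y (j div 2)) [0..<2 * l]"
  have len: "length c = 2 * l" by (simp add: c_def)
  have ev: "c ! (2 * a) = xs ! a" and od: "c ! Suc (2 * a) = y a" if "a < l" for a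
    using that by (simp_all add: c_def)
  have parity: thesis if "\<And>a. i = 2 * a \<Longrightarrow> a < l \<Longrightarrow> thesis" "\<And>a. i = Suc (2 * a) \<Longrightarrow> a < l \<Longrightarrow> thesis" "i < 2 * l"
    for i thesis
    using that by (cases "even i") (auto elim!: evenE oddE)
  have "c ! i \<noteq> c ! j" if "i < 2 * l" "j < 2 * l" "i \<noteq> j" for i j
    using that(1,2,3)
    by (rule_tac i = i in parity; rule_tac i = j in parity) (auto simp: ev od inj yinj xy xy[symmetric])
  then have "distinct c" by (simp add: distinct_conv_nth len)
  moreover have "set c \<subseteq> verts G"
    using x1 y(1) by (auto simp: c_def verts_def)
  moreover have "{c ! i, c ! j} \<in> edges G \<longleftrightarrow> j = Suc i \<or> i = 0 \<and> j = 2 * l - 1"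
    if ij: "i < j" "j < 2 * l" for i j
  proof -
    have il: "i < 2 * l" using ij by simp
    show ?thesis
    proof (rule parity[OF _ _ il])
      fix a assume a: "i = 2 * a" "a < l"
      show ?thesis
      proof (rule parity[OF _ _ ij(2)])
        fix b assume b: "j = 2 * b" "b < l"
        then have "{c ! i, c ! j} \<notin> edges G" using a no1 x1 by (simp add: ev)
        moreover have "j \<noteq> Suc i" "j \<noteq> 2 * l - 1" using a b by arith+
        ultimately show ?thesis by simp
      next
        fix b assume b: "j = Suc (2 * b)" "b < l"
        then have "{c ! i, c ! j} \<in> edges G \<longleftrightarrow> a = b \<or> a = nx b"
          using a adj by (simp add: ev od insert_commute)
        moreover have "a = nx b \<longleftrightarrow> a = 0 \<and> Suc b = l" using a b ij(1) by (simp add: nx_def)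
        moreover have "j = Suc i \<longleftrightarrow> a = b" using a b by auto
        moreover have "i = 0 \<and> j = 2 * l - 1 \<longleftrightarrow> a = 0 \<and> Suc b = l" using a b by arith
        ultimately show ?thesis by simp
      qed
    next
      fix a assume a: "i = Suc (2 * a)" "a < l"
      show ?thesis
      proof (rule parity[OF _ _ ij(2)])
        fix b assume b: "j = 2 * b" "b < l"
        then have "{c ! i, c ! j} \<in> edges G \<longleftrightarrow> b = a \<or> b = nx a"
          using a adj by (simp add: ev od)
        moreover have "b = nx a \<longleftrightarrow> b = Suc a" using a b ij(1) by (simp add: nx_def)
        moreover have "j = Suc i \<longleftrightarrow> b = Suc a" using a b by auto
        moreover have "i \<noteq> 0" "a \<noteq> b" using a b ij(1) by auto
        ultimately show ?thesis by simp
      next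
        fix b assume b: "j = Suc (2 * b)" "b < l"
        then have "{c ! i, c ! j} \<notin> edges G" using a no2 y(1) by (simp add: od)
        moreover have "j \<noteq> Suc i" "i \<noteq> 0" using a b by arith+
        ultimately show ?thesis by simp
      qed
    qed
  qed
  ultimately have "induced_cycle G c" using l by (simp add: induced_cycle_def len)
  then show ?thesis using len l_def by blast
qed

text \<open>
  While some vertex of \<open>X\<close> lies on at most \<open>p \<sqdot> m\<close> edges, its removal keeps the density of the
  multigraph on \<open>X\<close>. Once there is none, each vertex has more than \<open>m\<close> distinct neighbours in the
  multigraph, as no pair is joined by more than \<open>p\<close> edges, and a long cycle can be subdivided.
\<close>

lemma dense_incidence_imp_induced_cycle:
  assumes G: "bipartite_graph G"
    and codeg: "\<And>x z. x \<in> part1 G \<Longrightarrow> z \<in> part1 G \<Longrightarrow> x \<noteq> z \<Longrightarrow> card (nbhd G x \<inter> nbhd G z) \<le> p"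
    and m: "m \<ge> 2"
    and "finite X" "X \<subseteq> part1 G"
    and "card {y \<in> part2 G. card (nbhd G y \<inter> X) = 2} > p * m * card X"
  shows "\<exists>c. induced_cycle G c \<and> length c > 2 * m"
  using assms(4-)
proof (induction X rule: finite_psubset_induct)
  case (psubset X)
  define Y where "Y X = {y \<in> part2 G. card (nbhd G y \<inter> X) = 2}" for X
  have finY: "finite (Y X)" for X using finite_parts[OF G] by (simp add: Y_def)
  have big: "card (Y X) > p * m * card X" using psubset.prems by (simp add: Y_def)
  show ?case
  proof (cases "\<exists>x\<in>X. card {y \<in> Y X. x \<in> nbhd G y} \<le> p * m")
    case True
    then obtain x where x: "x \<in> X" "card {y \<in> Y X. x \<in> nbhd G y} \<le> p * m" by blast
    have "nbhd G y \<inter> (X - {x}) = nbhd G y \<inter> X" if "x \<notin> nbhd G y" for y using that by blast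
    then have "y \<in> Y (X - {x}) \<union> {y \<in> Y X. x \<in> nbhd G y}" if "y \<in> Y X" for y
      using that by (cases "x \<in> nbhd G y") (simp_all add: Y_def)
    then have "Y X \<subseteq> Y (X - {x}) \<union> {y \<in> Y X. x \<in> nbhd G y}" by blast
    then have "card (Y X) \<le> card (Y (X - {x}) \<union> {y \<in> Y X. x \<in> nbhd G y})"
      using finY by (intro card_mono) auto
    also have "\<dots> \<le> card (Y (X - {x})) + p * m"
      using x(2) by (intro order.trans[OF card_Un_le]) simp
    finally have "p * m * card X < card (Y (X - {x})) + p * m" using big by simp
    moreover have "card X = Suc (card (X - {x}))" using x(1) psubset.hyps by (simp only: card_Suc_Diff1)
    ultimately have "p * m * card (X - {x}) < card (Y (X - {x}))" by simp
    then show ?thesis using psubset.IH[of "X - {x}"] x(1) psubset.prems(1) unfolding Y_def by blast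
  next
    case False
    define r where "r x z \<longleftrightarrow> x \<noteq> z \<and> (\<exists>y\<in>part2 G. nbhd G y \<inter> X = {x, z})" for x z
    have deg: "m \<le> card {z \<in> X. r x z}" if x: "x \<in> X" for x
    proof -
      let ?Z = "{z \<in> X. r x z}"
      have "{y \<in> Y X. x \<in> nbhd G y} \<subseteq> (\<Union>z\<in>?Z. nbhd G x \<inter> nbhd G z)"
      proof clarify
        fix y assume y: "y \<in> Y X" "x \<in> nbhd G y"
        then have "card (nbhd G y \<inter> X) = 2" by (simp add: Y_def)
        then obtain u v where uv: "nbhd G y \<inter> X = {u, v}" "u \<noteq> v" by (auto simp: card_2_iff)
        have "x \<in> {u, v}" using x y(2) uv(1)[symmetric] by simp
        then obtain z where z: "nbhd G y \<inter> X = {x, z}" "x \<noteq> z"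
          using uv by (metis insert_commute insertE singletonD)
        have zy: "z \<in> nbhd G y \<inter> X" using z(1) by simp
        moreover have "r x z" using z y(1) by (auto simp: r_def Y_def)
        moreover have "y \<in> nbhd G x \<inter> nbhd G z"
          using zy y(2) by (simp add: nbhd_commute[of y])
        ultimately show "y \<in> (\<Union>z\<in>?Z. nbhd G x \<inter> nbhd G z)" by blast
      qed
      moreover have "finite (nbhd G x)"
        using nbhd_part1[OF G] x psubset.prems(1) finite_parts[OF G] by (meson finite_subset subsetD)
      ultimately have "card {y \<in> Y X. x \<in> nbhd G y} \<le> card (\<Union>z\<in>?Z. nbhd G x \<inter> nbhd G z)"
        using psubset.hyps by (intro card_mono) auto
      also have "\<dots> \<le> (\<Sum>z\<in>?Z. card (nbhd G x \<inter> nbhd G z))"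
        using psubset.hyps by (intro card_UN_le) simp
      also have "\<dots> \<le> (\<Sum>z\<in>?Z. p)"
        using psubset.prems(1) x by (intro sum_mono codeg) (auto simp: r_def)
      finally have "card {y \<in> Y X. x \<in> nbhd G y} \<le> p * card ?Z" by (simp add: mult.commute)
      moreover have "p * m < card {y \<in> Y X. x \<in> nbhd G y}" using False x not_le by blast
      ultimately have "p * m < p * card ?Z" by (rule order.strict_trans2[rotated])
      then show ?thesis by simp
    qed
    have "X \<noteq> {}" using big by (auto simp: Y_def)
    then obtain xs where xs: "distinct xs" "set xs \<subseteq> X" "length xs > m"
      "\<And>i. i < length xs \<Longrightarrow> r (xs ! i) (xs ! (Suc i mod length xs))"
      using min_degree_imp_long_cycle[of X m r] psubset.hyps m deg by (auto simp: r_def insert_commute)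
    have "\<exists>c. induced_cycle G c \<and> length c = 2 * length xs"
      using xs psubset.prems(1) m by (intro induced_cycle_subdivision[OF G, of xs X]) (auto simp: r_def)
    then show ?thesis using xs(3) by auto
  qed
qed

section \<open>Random subsets\<close>

text \<open>
  The expected number \<open>D / m\<close> of successes lies between 1 and 2, so exactly two successes have a
  probability bounded below.
\<close>

lemma binomial_two_lower_bound:
  fixes m D :: nat
  assumes m: "even m" "m \<ge> 2" and D: "m \<le> D" "D < 2 * m"
  shows "1 / 64 \<le> real (D choose 2) * (1 / m) ^ 2 * (1 - 1 / m) ^ (D - 2)"
proof -
  obtain h where h: "m = 2 * h" using m(1) by (elim evenE)
  have mpos: "real m \<ge> 2" using m(2) by simp
  \<comment> \<open>Evenness makes \<open>h = m / 2\<close> available as an exponent, where the Bernoulli inequality yields 1/2.\<close>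
  have "1 / 2 \<le> (1 - 1 / m) ^ h"
    using Bernoulli_inequality[of "- 1 / real m" h] mpos h by simp
  then have "(1 / 2) ^ 4 \<le> ((1 - 1 / m) ^ h) ^ 4" by (intro power_mono) auto
  also have "\<dots> = (1 - 1 / m) ^ (2 * m)" by (simp add: h power_mult[symmetric] mult.commute)
  also have "\<dots> \<le> (1 - 1 / m) ^ (D - 2)" using D mpos by (intro power_decreasing) auto
  finally have 1: "1 / 16 \<le> (1 - 1 / m) ^ (D - 2)" by (simp add: power4_eq_xxxx)
  have "real (m choose 2) \<le> real (D choose 2)" using D by (simp add: binomial_right_mono)
  moreover have "real (m choose 2) = m * (m - 1) / 2"
    using m(1) by (simp add: choose_two real_of_nat_div del: of_nat_mult)
  moreover have "real m * m / 4 \<le> m * (m - 1) / 2"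
  proof -
    have "m * m \<le> 2 * (m * (m - 1))" using m(2) by (cases m) (auto simp: algebra_simps)
    then have "real (m * m) \<le> real (2 * (m * (m - 1)))" by (simp only: of_nat_le_iff)
    then show ?thesis by simp
  qed
  ultimately have "real m * m / 4 \<le> real (D choose 2)" by simp
  then have "real m * m / 4 * (1 / m) ^ 2 \<le> real (D choose 2) * (1 / m) ^ 2"
    by (intro mult_right_mono) auto
  moreover have "real m * m / 4 * (1 / m) ^ 2 = 1 / 4" using mpos by (simp add: power2_eq_square field_simps)
  ultimately have 2: "1 / 4 \<le> real (D choose 2) * (1 / m) ^ 2" by simp
  have "(1 / 4) * (1 / 16) \<le> real (D choose 2) * (1 / m) ^ 2 * (1 - 1 / m) ^ (D - 2)"
    using 1 2 by (intro mult_mono) auto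
  then show ?thesis by simp
qed

text \<open>
  A random subset of \<open>A\<close> with density \<open>1 / m\<close> meets each \<open>N b\<close> in exactly two elements with
  probability at least \<open>1 / 64\<close>. The expectation of the hypothesis on \<open>X\<close> then reads
  \<open>card B / 64 \<le> K \<sqdot> card A / m\<close>.
\<close>

lemma card_le_if_few_hit_twice:
  fixes N :: "'b \<Rightarrow> 'a set" and K :: nat
  assumes A: "finite A" and B: "finite B"
    and N: "\<And>b. b \<in> B \<Longrightarrow> N b \<subseteq> A \<and> m \<le> card (N b) \<and> card (N b) < 2 * m"
    and m: "even m" "m \<ge> 2"
    and K: "\<And>X. X \<subseteq> A \<Longrightarrow> card {b \<in> B. card (N b \<inter> X) = 2} \<le> K * card X"
  shows "real (card B) * m \<le> 64 * K * card A"
proof -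
  define q where "q = 1 / real m"
  have q: "q \<in> {0..1}" using m by (auto simp: q_def)
  define M where "M = Pi_pmf A False (\<lambda>_. bernoulli_pmf q)"
  have fin: "finite (set_pmf M)" unfolding M_def
    using A set_Pi_pmf[of A False "\<lambda>_. bernoulli_pmf q"] by (auto intro!: finite_PiE_dflt)
  have int: "integrable (measure_pmf M) f" for f :: "('a \<Rightarrow> bool) \<Rightarrow> real"
    using fin by (rule integrable_measure_pmf_finite)
  have cnt: "map_pmf (\<lambda>f. card {x \<in> S. f x}) M = binomial_pmf (card S) q" if "S \<subseteq> A" for S
  proof -
    have "binomial_pmf (card S) q = map_pmf (\<lambda>f. card {x \<in> S. f x}) (Pi_pmf S False (\<lambda>_. bernoulli_pmf q))"
      using that A q by (intro binomial_pmf_altdef') (auto intro: finite_subset)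
    also have "\<dots> = map_pmf (\<lambda>f. card {x \<in> S. f x}) M"
      unfolding M_def Pi_pmf_subset[OF A that] pmf.map_comp
      by (intro map_pmf_cong) (auto intro!: arg_cong[where f = card])
    finally show ?thesis by simp
  qed
  have hit: "1 / 64 \<le> measure_pmf.expectation M (\<lambda>f. of_bool (card {x \<in> N b. f x} = 2) :: real)" if b: "b \<in> B" for b
  proof -
    have "1 / 64 \<le> pmf (binomial_pmf (card (N b)) q) 2"
      using binomial_two_lower_bound[OF m] N[OF b] q unfolding q_def by simp
    also have "\<dots> = measure_pmf.prob M ((\<lambda>f. card {x \<in> N b. f x}) -` {2})"
      using cnt[of "N b"] N[OF b] by (simp add: pmf_map[symmetric])
    also have "\<dots> = measure_pmf.expectation M (indicator ((\<lambda>f. card {x \<in> N b. f x}) -` {2}))"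
      by simp
    also have "\<dots> = measure_pmf.expectation M (\<lambda>f. of_bool (card {x \<in> N b. f x} = 2))"
      by (intro Bochner_Integration.integral_cong) (auto simp: indicator_def)
    finally show ?thesis .
  qed
  have single: "measure_pmf.expectation M (\<lambda>f. of_bool (f x) :: real) = q" if x: "x \<in> A" for x
  proof -
    have "measure_pmf.expectation M (\<lambda>f. of_bool (f x) :: real) =
        measure_pmf.expectation (map_pmf (\<lambda>f. f x) M) (\<lambda>v. of_bool v)"
      by (simp only: integral_map_pmf)
    also have "map_pmf (\<lambda>f. f x) M = bernoulli_pmf q"
      using Pi_pmf_component[OF A, of x False "\<lambda>_. bernoulli_pmf q"] x by (simp add: M_def)
    finally show ?thesis using q by simp
  qed
  have "real (card B) * (1 / 64) \<le> (\<Sum>b\<in>B. measure_pmf.expectation M (\<lambda>f. of_bool (card {x \<in> N b. f x} = 2)))"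
    using sum_mono[of B "\<lambda>_. 1 / 64", OF hit] by simp
  also have "\<dots> = measure_pmf.expectation M (\<lambda>f. \<Sum>b\<in>B. of_bool (card {x \<in> N b. f x} = 2))"
    using int by (intro Bochner_Integration.integral_sum[symmetric])
  also have "\<dots> \<le> measure_pmf.expectation M (\<lambda>f. real K * (\<Sum>x\<in>A. of_bool (f x)))"
  proof (rule integral_mono[OF int int])
    fix f :: "'a \<Rightarrow> bool"
    let ?X = "{x \<in> A. f x}"
    have "{b \<in> B. card {x \<in> N b. f x} = 2} = {b \<in> B. card (N b \<inter> ?X) = 2}"
    proof -
      have "{x \<in> N b. f x} = N b \<inter> ?X" if "b \<in> B" for b using N[OF that] by blast
      then show ?thesis by auto
    qed
    then have "card {b \<in> B. card {x \<in> N b. f x} = 2} \<le> K * card ?X" using K[of ?X] by auto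
    then have "real (card {b \<in> B. card {x \<in> N b. f x} = 2}) \<le> real (K * card ?X)" by (simp only: of_nat_le_iff)
    then show "(\<Sum>b\<in>B. of_bool (card {x \<in> N b. f x} = 2)) \<le> real K * (\<Sum>x\<in>A. of_bool (f x))"
      using A B by (simp add: sum_of_bool_eq Int_def)
  qed
  also have "\<dots> = real K * (\<Sum>x\<in>A. measure_pmf.expectation M (\<lambda>f. of_bool (f x)))"
    using int by (simp add: Bochner_Integration.integral_sum)
  also have "\<dots> = real K * (card A * q)" using single by simp
  finally have "real (card B) * (1 / 64) \<le> real K * (card A * q)" .
  then show ?thesis using m(2) by (simp add: q_def field_simps)
qed

text \<open>
  Sets of sizes in \<open>{2^i..<2^(i+1)}\<close> are counted with density \<open>2^-i\<close>. The resulting bounds form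
  a geometric series that starts at \<open>i0\<close>, so arbitrarily irregular sizes cost only a factor 2.
\<close>

lemma card_less_if_few_hit_twice:
  fixes N :: "'b \<Rightarrow> 'a set" and K :: nat
  assumes A: "finite A" "A \<noteq> {}" and B: "finite B"
    and N: "\<And>b. b \<in> B \<Longrightarrow> N b \<subseteq> A \<and> 2 ^ i0 \<le> card (N b)"
    and i0: "128 * K < 2 ^ i0" "i0 \<ge> 1"
    and K: "\<And>X. X \<subseteq> A \<Longrightarrow> card {b \<in> B. card (N b \<inter> X) = 2} \<le> K * card X"
  shows "card B < card A"
proof -
  define D where "D i = {b \<in> B. 2 ^ i \<le> card (N b) \<and> card (N b) < 2 * 2 ^ i}" for i
  define n where "n = card A"
  have each: "real (card (D i)) \<le> 64 * K * card A * (1 / 2) ^ i" if "i \<ge> i0" for i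
  proof -
    have "real (card (D i)) * (2 ^ i :: nat) \<le> 64 * K * card A"
    proof (rule card_le_if_few_hit_twice[OF A(1), of "D i" N])
      show "finite (D i)" using B by (simp add: D_def)
      show "even (2 ^ i :: nat)" "2 \<le> (2 ^ i :: nat)" using that i0(2) by (auto simp: self_le_power)
      show "N b \<subseteq> A \<and> 2 ^ i \<le> card (N b) \<and> card (N b) < 2 * 2 ^ i" if "b \<in> D i" for b
        using that N by (auto simp: D_def)
      fix X assume X: "X \<subseteq> A"
      have "card {b \<in> D i. card (N b \<inter> X) = 2} \<le> card {b \<in> B. card (N b \<inter> X) = 2}"
        using B by (intro card_mono) (auto simp: D_def)
      then show "card {b \<in> D i. card (N b \<inter> X) = 2} \<le> K * card X" using K[OF X] by simp
    qed
    then show ?thesis by (simp add: field_simps)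
  qed
  have "B \<subseteq> (\<Union>i\<in>{i0..<i0 + n}. D i)"
  proof
    fix b assume b: "b \<in> B"
    define c where "c = card (N b)"
    have c: "2 ^ i0 \<le> c" using N b by (simp add: c_def)
    have cn: "c \<le> n" using N[OF b] A(1) by (simp add: c_def n_def card_mono)
    have c0: "0 < c" using c by (metis not_gr_zero not_le zero_less_numeral zero_less_power)
    obtain i where i: "2 ^ i \<le> c" "c < 2 ^ (i + 1)" using ex_power_ivl1[of 2 c] c0 by auto
    have "(2 :: nat) ^ i0 < 2 ^ (i + 1)" using c i(2) by (rule le_less_trans)
    then have "i0 < i + 1" by (rule power_less_imp_less_exp[rotated]) simp
    moreover have "i < n" using i(1) cn less_exp[of i] by linarith
    ultimately have "i \<in> {i0..<i0 + n}" by simp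
    moreover have "b \<in> D i" using i b by (simp add: D_def c_def)
    ultimately show "b \<in> (\<Union>i\<in>{i0..<i0 + n}. D i)" by blast
  qed
  then have "card B \<le> card (\<Union>i\<in>{i0..<i0 + n}. D i)" using B by (intro card_mono) (auto simp: D_def)
  also have "\<dots> \<le> (\<Sum>i\<in>{i0..<i0 + n}. card (D i))" by (intro card_UN_le) simp
  finally have "real (card B) \<le> real (\<Sum>i\<in>{i0..<i0 + n}. card (D i))" by (simp only: of_nat_le_iff)
  also have "\<dots> = (\<Sum>i\<in>{i0..<i0 + n}. real (card (D i)))" by simp
  also have "\<dots> \<le> (\<Sum>i\<in>{i0..<i0 + n}. 64 * K * card A * (1 / 2) ^ i)"
    using each by (intro sum_mono) auto
  also have "\<dots> = 64 * K * card A * (\<Sum>i\<in>{i0..<i0 + n}. (1 / 2) ^ i)" by (simp add: sum_distrib_left)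
  also have "(\<Sum>i\<in>{i0..<i0 + n}. (1 / 2 :: real) ^ i) \<le> 2 * (1 / 2) ^ i0"
  proof -
    have "(\<Sum>i\<in>{i0..<i0 + n}. (1 / 2 :: real) ^ i) = 2 * (1 / 2) ^ i0 - 2 * (1 / 2) ^ (i0 + n)"
      by (induction n) simp_all
    then show ?thesis by simp
  qed
  finally have "real (card B) \<le> 64 * K * card A * (2 * (1 / 2) ^ i0)" by (simp add: mult_left_mono)
  also have "\<dots> = (128 * K / 2 ^ i0) * card A" by (simp add: field_simps)
  also have "\<dots> < 1 * real (card A)"
  proof (rule mult_strict_right_mono)
    have "real (128 * K) < real (2 ^ i0)" using i0(1) by (simp only: of_nat_less_iff)
    then show "real (128 * K) / 2 ^ i0 < 1" by simp
    show "0 < real (card A)" using A by (simp add: card_gt_0_iff)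
  qed
  finally show ?thesis by simp
qed

section \<open>Graphs without the forbidden subgraph\<close>

text \<open>
  The parts of a copy: \<open>a\<close> and \<open>b\<close> on one side; \<open>p\<close> common neighbours, \<open>s\<close> private neighbours of
  \<open>a\<close> and the isolated vertex \<open>w\<close> on the other.
\<close>

lemma forbidden_embedding:
  assumes G: "bipartite_graph G" and ab: "a \<in> part1 G" "b \<in> part1 G" "a \<noteq> b"
    and p: "p \<le> card (nbhd G a \<inter> nbhd G b)" and s: "s \<le> card (nbhd G a - nbhd G b)"
    and w: "w \<in> part2 G" "w \<notin> nbhd G a" "w \<notin> nbhd G b"
  shows "contains_induced G (L_plus_O01 s p)"
proof -
  obtain P where P: "P \<subseteq> nbhd G a \<inter> nbhd G b" "card P = p" "finite P"
    using obtain_subset_with_card_n[OF p] by blast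
  obtain S where S: "S \<subseteq> nbhd G a - nbhd G b" "card S = s" "finite S"
    using obtain_subset_with_card_n[OF s] by blast
  obtain ps where ps: "set ps = P" "distinct ps" using finite_distinct_list[OF P(3)] by blast
  obtain ss where ss: "set ss = S" "distinct ss" using finite_distinct_list[OF S(3)] by blast
  have lps: "length ps = p" using ps P distinct_card by metis
  have lss: "length ss = s" using ss S distinct_card by metis
  \<comment> \<open>Position \<open>i\<close> of this list is the image of the vertex \<open>i + 2\<close> of the forbidden graph.\<close>
  define qs where "qs = ps @ ss @ [w]"
  have len: "length qs = p + s + 1" by (simp add: qs_def lps lss)
  have dist: "distinct qs" using ps ss P(1) S(1) w by (auto simp: qs_def)
  have qs2: "set qs \<subseteq> part2 G"
    using ps ss P(1) S(1) w nbhd_part1[OF G ab(1)] by (auto simp: qs_def)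
  have qcases: "i < p \<and> qs ! i \<in> P \<or> p \<le> i \<and> i < p + s \<and> qs ! i \<in> S \<or> i = p + s \<and> qs ! i = w"
    if "i < length qs" for i
    using that nth_mem[of i ps] nth_mem[of "i - p" ss] ps ss
    by (auto simp: qs_def nth_append lps lss)
  have qa: "qs ! i \<in> nbhd G a \<longleftrightarrow> i < p + s" and qb: "qs ! i \<in> nbhd G b \<longleftrightarrow> i < p"
    if "i < length qs" for i
    using qcases[OF that] P(1) S(1) w by auto
  have disj: "part1 G \<inter> part2 G = {}" using G by (simp add: bipartite_graph_def)
  have no1: "{u, v} \<notin> edges G" if "u \<in> part1 G" "v \<in> part1 G" for u v
    using nbhd_part1[OF G that(1)] that disj by (auto simp: nbhd_def)
  have no2: "{u, v} \<notin> edges G" if "u \<in> part2 G" "v \<in> part2 G" for u v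
    using nbhd_part2[OF G that(1)] that disj by (auto simp: nbhd_def)
  let ?H = "L_plus_O01 s p"
  have H1: "part1 ?H = {..<2}" and H2: "part2 ?H = {2..<2 + length qs}"
    by (auto simp: L_plus_O01_def L_def len)
  have vH: "verts ?H = {..<2 + length qs}" unfolding verts_def H1 H2 by auto
  have H0: "{u, v} \<notin> edges ?H" if "u < 2 \<and> v < 2 \<or> 2 \<le> u \<and> 2 \<le> v" for u v
    using that by (auto simp: L_plus_O01_def L_def doubleton_eq_iff)
  have HE: "{u, v} \<in> edges ?H \<longleftrightarrow> v < 2 + p \<or> u = 0 \<and> v < 2 + p + s" if "u < 2" "2 \<le> v" for u v
  proof -
    have "u = 0 \<or> u = 1" using that(1) by auto
    then show ?thesis
      using that by (cases "v < 2 + p") (auto simp: L_plus_O01_def L_def doubleton_eq_iff)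
  qed
  define f where "f v = (if v = 0 then a else if v = 1 then b else qs ! (v - 2))" for v :: nat
  have f1: "f v = (if v = 0 then a else b)" if "v < 2" for v using that by (auto simp: f_def)
  have f2: "f v = qs ! (v - 2)" if "2 \<le> v" for v using that by (auto simp: f_def)
  have fp1: "f v \<in> part1 G" if "v < 2" for v using f1[OF that] ab by simp
  have fp2: "f v \<in> part2 G" if "2 \<le> v" "v < 2 + length qs" for v
    using f2[OF that(1)] qs2 that nth_mem[of "v - 2" qs] by (metis add_diff_inverse_nat nat_add_left_cancel_less not_le subsetD)
  have cross: "{f u, f v} \<in> edges G \<longleftrightarrow> {u, v} \<in> edges ?H"
    if "u < 2" "2 \<le> v" "v < 2 + length qs" for u v
  proof -
    have i: "v - 2 < length qs" using that by simp
    have "{f u, f v} \<in> edges G \<longleftrightarrow> qs ! (v - 2) \<in> nbhd G (if u = 0 then a else b)"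
      using f1[OF that(1)] f2[OF that(2)] by (simp add: nbhd_def)
    also have "\<dots> \<longleftrightarrow> v - 2 < p \<or> u = 0 \<and> v - 2 < p + s" using qa[OF i] qb[OF i] by auto
    also have "\<dots> \<longleftrightarrow> {u, v} \<in> edges ?H" unfolding HE[OF that(1,2)] using that(2) by auto
    finally show ?thesis .
  qed
  have "inj_on f (verts ?H)"
  proof (rule inj_onI)
    fix u v assume uv: "u \<in> verts ?H" "v \<in> verts ?H" "f u = f v"
    have "u < 2 \<longleftrightarrow> v < 2"
      using uv fp1[of u] fp1[of v] fp2[of u] fp2[of v] disj unfolding vH by (force simp: not_less)
    then consider "u < 2" "v < 2" | "2 \<le> u" "2 \<le> v" by linarith
    then show "u = v"
    proof cases
      case 1
      then show ?thesis using uv(3) ab(3) by (auto simp: f1 split: if_splits)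
    next
      case 2
      then have "u - 2 = v - 2"
        using uv dist unfolding vH by (auto simp: f2 nth_eq_iff_index_eq)
      then show ?thesis using 2 by simp
    qed
  qed
  moreover have "\<forall>u\<in>verts ?H. \<forall>v\<in>verts ?H. {f u, f v} \<in> edges G \<longleftrightarrow> {u, v} \<in> edges ?H"
  proof (intro ballI)
    fix u v assume uv: "u \<in> verts ?H" "v \<in> verts ?H"
    then have l: "u < 2 + length qs" "v < 2 + length qs" unfolding vH by auto
    consider "u < 2" "v < 2" | "2 \<le> u" "2 \<le> v" | "u < 2" "2 \<le> v" | "2 \<le> u" "v < 2" by linarith
    then show "{f u, f v} \<in> edges G \<longleftrightarrow> {u, v} \<in> edges ?H"
    proof cases
      case 1 then show ?thesis using no1[OF fp1 fp1] H0 by blast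
    next
      case 2 then show ?thesis using no2[OF fp2[OF _ l(1)] fp2[OF _ l(2)]] H0 by blast
    next
      case 3 then show ?thesis using cross l by blast
    next
      case 4 then show ?thesis using cross[of v u] l by (simp add: insert_commute)
    qed
  qed
  moreover have "f ` part1 ?H \<subseteq> part1 G \<and> f ` part2 ?H \<subseteq> part2 G"
    unfolding H1 H2 using fp1 fp2 by auto
  ultimately show ?thesis unfolding contains_induced_def by blast
qed

text \<open>
  A symmetric difference larger than \<open>2 \<sqdot> s\<close> gives one of the two vertices \<open>s\<close> private neighbours;
  a vertex outside both neighbourhoods would then serve as the isolated vertex.
\<close>

lemma overlapping_pair_dominates:
  assumes G: "bipartite_graph G" "free_of (L_plus_O01 s p) G"
    and ab: "a \<in> part1 G" "b \<in> part1 G" "a \<noteq> b"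
    and p: "p \<le> card (nbhd G a \<inter> nbhd G b)"
    and s: "2 * s < card (sym_diff (nbhd G a) (nbhd G b))"
  shows "nbhd G a \<union> nbhd G b = part2 G"
proof (rule ccontr)
  have sub: "nbhd G a \<union> nbhd G b \<subseteq> part2 G" using nbhd_part1[OF G(1)] ab by blast
  assume "nbhd G a \<union> nbhd G b \<noteq> part2 G"
  then obtain w where w: "w \<in> part2 G" "w \<notin> nbhd G a" "w \<notin> nbhd G b" using sub by blast
  have "2 * s < card (nbhd G a - nbhd G b) + card (nbhd G b - nbhd G a)"
    using s card_Un_le[of "nbhd G a - nbhd G b" "nbhd G b - nbhd G a"] by linarith
  then consider "s \<le> card (nbhd G a - nbhd G b)" | "s \<le> card (nbhd G b - nbhd G a)" by linarith
  then show False
  proof cases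
    case 1
    then show False using forbidden_embedding[OF G(1) ab p _ w] G(2) by (simp add: free_of_def)
  next
    case 2
    then show False
      using forbidden_embedding[OF G(1) ab(2,1) _ _ _ w(1,3,2)] p ab(3) G(2)
      by (simp add: free_of_def Int_commute)
  qed
qed

lemma nbhd_remove_vertex:
  assumes "bipartite_graph G" "x \<in> part1 G" "y \<in> part1 G" "x \<noteq> y"
  shows "nbhd (remove_vertex G x) y = nbhd G y"
proof -
  have "x \<notin> nbhd G y" using nbhd_part1[OF assms(1,3)] assms(1,2) by (auto simp: bipartite_graph_def)
  then show ?thesis using assms(4) by (auto simp: nbhd_def remove_vertex_def)
qed

lemma not_describable_imp:
  assumes G: "bipartite_graph G" and nd: "\<not> describable C G x" and x: "x \<in> part1 G"
  shows "C < card (nbhd G x)" "C < card (part2 G - nbhd G x)"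
    "\<And>y. y \<in> part1 G \<Longrightarrow> x \<noteq> y \<Longrightarrow> C < card (sym_diff (nbhd G x) (nbhd G y))"
proof -
  have far: "C < card (sym_diff (nbhd G x) M)" if "M \<in> templates (remove_vertex G x)" for M
    using nd x that unfolding describable_def by (meson not_le)
  show "C < card (nbhd G x)" using far[of "{}"] by (simp add: templates_def)
  have "x \<notin> part2 G" using G x by (auto simp: bipartite_graph_def)
  then have "part2 G \<in> templates (remove_vertex G x)" by (simp add: templates_def remove_vertex_def)
  moreover have "sym_diff (nbhd G x) (part2 G) = part2 G - nbhd G x" using nbhd_part1[OF G x] by blast
  ultimately show "C < card (part2 G - nbhd G x)" using far by metis
  fix y assume y: "y \<in> part1 G" "x \<noteq> y"
  then have "nbhd G y \<in> templates (remove_vertex G x)"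
    unfolding templates_def nbhd_remove_vertex[OF G x y, symmetric] by (simp add: remove_vertex_def)
  then show "C < card (sym_diff (nbhd G x) (nbhd G y))" by (rule far)
qed

text \<open>
  Pairs of \<open>part1 G\<close> overlap in at most \<open>p\<close> vertices or dominate \<open>part2 G\<close>. A single dominating
  pair would force all pairs to dominate, and then each vertex of \<open>part2 G\<close> would have at most one
  non-neighbour and be describable by its opposite part.
\<close>

lemma few_common_neighbours:
  assumes G: "bipartite_graph G" "free_of (L_plus_O01 s p) G"
    and nd: "\<And>x. \<not> describable C G x" "\<And>x. \<not> describable C (swap G) x"
    and C: "2 * s + 2 * p + 1 \<le> C"
    and ab: "a \<in> part1 G" "b \<in> part1 G" "a \<noteq> b"
  shows "card (nbhd G a \<inter> nbhd G b) \<le> p"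
proof (rule ccontr)
  let ?N = "nbhd G"
  define cov where "cov x y \<longleftrightarrow> ?N x \<union> ?N y = part2 G" for x y
  have cov_sym: "cov x y \<Longrightarrow> cov y x" for x y by (simp add: cov_def Un_commute)
  have fin: "finite (part1 G)" "finite (part2 G)" using finite_parts[OF G(1)] by auto
  have N2: "?N x \<subseteq> part2 G" if "x \<in> part1 G" for x using nbhd_part1[OF G(1) that] .
  have finN: "finite (?N x)" if "x \<in> part1 G" for x using N2[OF that] fin(2) by (rule finite_subset)
  note nd1 = not_describable_imp[OF G(1) nd(1)]
  have dich: "cov x y" if "x \<in> part1 G" "y \<in> part1 G" "x \<noteq> y" "p < card (?N x \<inter> ?N y)" for x y
    using overlapping_pair_dominates[OF G that(1-3)] that(4) nd1(3)[OF that(1,2,3)] C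
    by (simp add: cov_def)
  \<comment> \<open>The more than \<open>C\<close> non-neighbours of \<open>x\<close> are common neighbours of \<open>y\<close> and \<open>z\<close>.\<close>
  have path: "cov y z" if "x \<in> part1 G" "y \<in> part1 G" "z \<in> part1 G" "y \<noteq> z" "cov x y" "cov x z" for x y z
  proof -
    have "part2 G - ?N x \<subseteq> ?N y \<inter> ?N z" using that(5,6) unfolding cov_def by blast
    then have "card (part2 G - ?N x) \<le> card (?N y \<inter> ?N z)"
      using finN[OF that(2)] by (intro card_mono) auto
    then show ?thesis using dich[OF that(2-4)] nd1(2)[OF that(1)] C by simp
  qed
  \<comment> \<open>Otherwise \<open>c\<close> would have at most \<open>2 \<sqdot> p\<close> neighbours, as \<open>x\<close> and \<open>y\<close> dominate.\<close>
  have third: "cov c x \<or> cov c y"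
    if "c \<in> part1 G" "x \<in> part1 G" "y \<in> part1 G" "cov x y" "c \<noteq> x" "c \<noteq> y" for c x y
  proof (rule ccontr)
    assume "\<not> (cov c x \<or> cov c y)"
    then have le: "card (?N c \<inter> ?N x) \<le> p" "card (?N c \<inter> ?N y) \<le> p"
      using dich[OF that(1,2,5)] dich[OF that(1,3,6)] not_le by blast+
    have "?N c = (?N c \<inter> ?N x) \<union> (?N c \<inter> ?N y)" using that(4) N2[OF that(1)] unfolding cov_def by blast
    then have "card (?N c) \<le> card (?N c \<inter> ?N x) + card (?N c \<inter> ?N y)" by (metis card_Un_le)
    then show False using le nd1(1)[OF that(1)] C by simp
  qed
  assume "\<not> card (?N a \<inter> ?N b) \<le> p"
  then have ab_cov: "cov a b" using dich[OF ab] by simp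
  have a_cov: "cov a c" if c: "c \<in> part1 G" "c \<noteq> a" for c
  proof (cases "c = b")
    case False
    then have "cov c a \<or> cov c b" using third[OF c(1) ab(1,2) ab_cov] c(2) by blast
    then show ?thesis
      using path[of b a c] c ab cov_sym[OF ab_cov] cov_sym by blast
  qed (use ab_cov in simp)
  have all: "cov x y" if "x \<in> part1 G" "y \<in> part1 G" "x \<noteq> y" for x y
    using a_cov path[OF ab(1) that] cov_sym that by metis
  have "?N a \<noteq> {}" using nd1(1)[OF ab(1)] by auto
  then obtain w where w: "w \<in> part2 G" using N2[OF ab(1)] by blast
  have "card (part1 G - ?N w) \<le> 1"
  proof (rule ccontr)
    assume "\<not> card (part1 G - ?N w) \<le> 1"
    then obtain x y where xy: "x \<in> part1 G - ?N w" "y \<in> part1 G - ?N w" "x \<noteq> y"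
      using fin(1) by (auto simp: card_le_Suc0_iff_eq)
    then have "w \<in> ?N x \<union> ?N y" using all[of x y] w by (auto simp: cov_def)
    then show False using xy by (simp add: nbhd_commute[of w])
  qed
  moreover have "C < card (part1 G - ?N w)"
    using not_describable_imp(2)[of "swap G" C w] G(1) nd(2) w by simp
  ultimately show False using C by simp
qed

text \<open>
  The first summands separate the two kinds of pairs; the power is the minimum degree that forces
  an induced cycle longer than \<open>k\<close>. With \<open>K = p \<sqdot> (k + 2)\<close>, its exponent \<open>128 \<sqdot> K + 1\<close> is a
  convenient choice of \<open>i0\<close> with \<open>128 \<sqdot> K < 2 ^ i0\<close>.
\<close>

definition describability_bound :: "nat \<Rightarrow> nat \<Rightarrow> nat \<Rightarrow> nat" where
  "describability_bound k s p = 2 * s + 2 * p + 1 + 2 ^ (128 * (p * (k + 2)) + 1)"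

text \<open>
  If no vertex is describable, the vertices of the larger part have large degree. As the vertices
  of the smaller part pairwise have few common neighbours and induced cycles are short, the counting
  over random subsets of the smaller part makes the larger part the smaller one.
\<close>

lemma ex_describable_if_part1_smaller:
  assumes G: "bipartite_graph G" "free_of (L_plus_O01 s p) G" "chordality_at_most k G"
    and ne: "verts G \<noteq> {}" and le: "card (part1 G) \<le> card (part2 G)"
  shows "\<exists>x. describable (describability_bound k s p) G x \<or> describable (describability_bound k s p) (swap G) x"
proof (rule ccontr)
  define K where "K = p * (k + 2)"
  define i0 where "i0 = 128 * K + 1"
  define C where "C = describability_bound k s p"
  have C: "2 * s + 2 * p + 1 \<le> C" "2 ^ i0 \<le> C" by (auto simp: C_def describability_bound_def i0_def K_def)
  assume "\<not> ?thesis"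
  then have nd: "\<not> describable C G x" "\<not> describable C (swap G) x" for x by (auto simp: C_def)
  have fin: "finite (part1 G)" "finite (part2 G)" using finite_parts[OF G(1)] by auto
  have deg: "C < card (nbhd G y)" if "y \<in> part2 G" for y
    using not_describable_imp(1)[of "swap G" C y] G(1) nd(2) that by simp
  have "part2 G \<noteq> {}"
    using ne le fin by (auto simp: verts_def)
  then obtain y where y: "y \<in> part2 G" by blast
  have "nbhd G y \<noteq> {}" using deg[OF y] by auto
  then have ne1: "part1 G \<noteq> {}" using nbhd_part2[OF G(1) y] by blast
  have "card (part2 G) < card (part1 G)"
  proof (rule card_less_if_few_hit_twice[OF fin(1) ne1 fin(2)])
    show "nbhd G b \<subseteq> part1 G \<and> 2 ^ i0 \<le> card (nbhd G b)" if "b \<in> part2 G" for b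
      using nbhd_part2[OF G(1) that] deg[OF that] C(2) by simp
    have "128 * K < i0" by (simp add: i0_def)
    also have "i0 < 2 ^ i0" by (rule less_exp)
    finally show "128 * K < 2 ^ i0" .
    show "1 \<le> i0" by (simp add: i0_def)
    fix X assume X: "X \<subseteq> part1 G"
    show "card {y \<in> part2 G. card (nbhd G y \<inter> X) = 2} \<le> K * card X"
    proof (rule ccontr)
      assume "\<not> ?thesis"
      then have "p * (k + 2) * card X < card {y \<in> part2 G. card (nbhd G y \<inter> X) = 2}"
        by (simp add: K_def)
      then obtain c where "induced_cycle G c" "length c > 2 * (k + 2)"
        using dense_incidence_imp_induced_cycle[OF G(1) few_common_neighbours[OF G(1,2) nd C(1)], of "k + 2" X]
          X fin(1) finite_subset by auto
      then show False using G(3) unfolding chordality_at_most_def by force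
    qed
  qed
  then show False using le by simp
qed

lemma ex_describable:
  assumes G: "bipartite_graph G" "free_of (L_plus_O01 s p) G" "chordality_at_most k G"
    and ne: "verts G \<noteq> {}"
  shows "\<exists>x. describable (describability_bound k s p) G x \<or> describable (describability_bound k s p) (swap G) x"
proof (cases "card (part1 G) \<le> card (part2 G)")
  case True
  then show ?thesis using ex_describable_if_part1_smaller[OF G ne] by blast
next
  case False
  then show ?thesis using ex_describable_if_part1_smaller[of "swap G" s p k] G ne by (auto simp: free_of_def)
qed

theorem theorem6:
  fixes k s p :: nat
  shows "at_most_factorial
           {G. bipartite_graph G \<and> free_of (L_plus_O01 s p) G \<and> chordality_at_most k G}"
proof (rule at_most_factorialI[OF hereditary_class])
  fix G :: "nat bigraph"
  assume "G \<in> {G. bipartite_graph G \<and> free_of (L_plus_O01 s p) G \<and> chordality_at_most k G}"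
    and "verts G \<noteq> {}"
  then show "\<exists>x. describable (describability_bound k s p) G x \<or> describable (describability_bound k s p) (swap G) x"
    using ex_describable by blast
qed

end
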